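(* Let $w \in S_n$ be a permutation. Then: (1) The first soliton $\mathrm{Row}_1(\mathrm{SD}(w))$ contains the ball $1$. (2) The first soliton $\mathrm{Row}_1(\mathrm{SD}(w))$ of $w$ is created after at most one BBS move. That is, the rightmost increasing run of $\mathrm{BB}^t(w)$ is equal to the first soliton of $w$ for all $t \ge 1$. (3) $\mathrm{Row}_1(\mathrm{SD}(w)) = \mathrm{Row}_1(P(w))$, where $P(w)$ is the Robinson--Schensted insertion tableau of $w$.
   Context: $\mathrm{Row}_1(T)$ denotes the first (top) row of a tableau $T$. Box-ball system (BBS). Boxes are indexed by $\mathbb{Z}$ from left to right. A BBS configuration (with $n$ balls) is a sequence $X$ indexed by $\mathbb{Z}$ in which each of $1,\dots,n$ (the balls) appears exactly once and every other entry is $e := n+1$ (an empty box). One BBS move transforms $X$ into $\mathrm{BB}(X)$: the balls $1,2,\dots,n$, in this order, each jump once, to the nearest box to the right of the ball that is empty at that moment (the box a ball leaves becomes empty). $\mathrm{BB}^t(X)$ is the result of $t$ BBS moves. A permutation $w = w_1\cdots w_n \in S_n$ (one-line notation) is regarded as the configuration with ball $w_i$ in box $i$ for $1\le i\le n$ and all other boxes empty. An increasing run of a configuration is a maximal contiguous (occupying consecutive boxes) increasing nonempty sequence of balls. A soliton is an increasing run that is preserved by all subsequent BBS moves (it remains an increasing run in all later configurations). A configuration is in steady state if every ball is contained in a soliton. Every box-ball system reaches steady state after finitely many moves, and then the sizes of the solitons weakly increase from left to right. The soliton decomposition $\mathrm{SD}(w)$ is the tableau whose first (top) row is the rightmost soliton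 of a steady-state configuration $\mathrm{BB}^t(w)$, whose second row is the second rightmost soliton, and so on. The first soliton of $w$ is the rightmost soliton in a steady-state configuration of the box-ball system containing $w$, i.e. the first row of $\mathrm{SD}(w)$. *)

theory Defs
  imports Main "HOL-Combinatorics.Permutations"
begin

section \<open>The box-ball system\<close>

text \<open>
  A configuration with \<open>n\<close> balls is a function \<open>X :: int \<Rightarrow> nat\<close>: the entry \<open>X p\<close> is the content of
  box \<open>p\<close>, the numbers \<open>1, \<dots>, n\<close> are the balls (each occurs exactly once) and \<open>n + 1\<close> stands for
  an empty box.
\<close>

definition jump :: "nat \<Rightarrow> nat \<Rightarrow> (int \<Rightarrow> nat) \<Rightarrow> (int \<Rightarrow> nat)" where
  "jump n k X =
     (let p = (THE p. X p = k); q = (LEAST q. p < q \<and> X q = n + 1)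
      in X(p := n + 1, q := k))"

definition bb :: "nat \<Rightarrow> (int \<Rightarrow> nat) \<Rightarrow> (int \<Rightarrow> nat)" where
  "bb n X = fold (jump n) [1..<n + 1] X"

definition perm_config :: "nat \<Rightarrow> (nat \<Rightarrow> nat) \<Rightarrow> (int \<Rightarrow> nat)" where
  "perm_config n w = (\<lambda>p. if 1 \<le> p \<and> p \<le> int n then w (nat p) else n + 1)"

section \<open>Increasing runs, solitons and steady states\<close>

definition increasing_block :: "nat \<Rightarrow> (int \<Rightarrow> nat) \<Rightarrow> int \<Rightarrow> int \<Rightarrow> bool" where
  "increasing_block n X a b \<longleftrightarrow>
     a \<le> b \<and> (\<forall>p\<in>{a..b}. X p \<in> {1..n}) \<and> strict_mono_on {a..b} X"

definition run_interval :: "nat \<Rightarrow> (int \<Rightarrow> nat) \<Rightarrow> int \<Rightarrow> int \<Rightarrow> bool" where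
  "run_interval n X a b \<longleftrightarrow>
     increasing_block n X a b \<and>
     (\<forall>a' b'. increasing_block n X a' b' \<and> {a..b} \<subseteq> {a'..b'} \<longrightarrow> a' = a \<and> b' = b)"

text \<open>
  As a run moves, its boxes change, so a run is identified with its sequence of balls, not with the
  interval of boxes it occupies. Since every ball occurs only once in a configuration, the interval
  can be recovered from the balls.
\<close>

definition increasing_run :: "nat \<Rightarrow> (int \<Rightarrow> nat) \<Rightarrow> nat list \<Rightarrow> bool" where
  "increasing_run n X xs \<longleftrightarrow> (\<exists>a b. run_interval n X a b \<and> xs = map X [a..b])"

definition rightmost_run :: "nat \<Rightarrow> (int \<Rightarrow> nat) \<Rightarrow> nat list \<Rightarrow> bool" where
  "rightmost_run n X xs \<longleftrightarrow>
     (\<exists>a b. run_interval n X a b \<and> xs = map X [a..b] \<and>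
            (\<forall>a' b'. run_interval n X a' b' \<longrightarrow> a' \<le> a))"

definition soliton_interval :: "nat \<Rightarrow> (int \<Rightarrow> nat) \<Rightarrow> int \<Rightarrow> int \<Rightarrow> bool" where
  "soliton_interval n X a b \<longleftrightarrow>
     run_interval n X a b \<and> (\<forall>t. increasing_run n ((bb n ^^ t) X) (map X [a..b]))"

definition steady :: "nat \<Rightarrow> (int \<Rightarrow> nat) \<Rightarrow> bool" where
  "steady n X \<longleftrightarrow> (\<forall>k\<in>{1..n}. \<exists>a b. soliton_interval n X a b \<and> k \<in> X ` {a..b})"

section \<open>Tableaux\<close>

text \<open>A tableau is the list of its rows, the top row first.\<close>

definition row1 :: "nat list list \<Rightarrow> nat list" where
  "row1 T = hd T"

definition soliton_rows :: "nat \<Rightarrow> (int \<Rightarrow> nat) \<Rightarrow> nat list list" where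
  "soliton_rows n X =
     map (\<lambda>a. map X [a..(THE b. soliton_interval n X a b)])
         (rev (sorted_list_of_set {a. \<exists>b. soliton_interval n X a b}))"

text \<open>
  The choice of the steady-state time is immaterial: solitons persist and keep their left-to-right
  order from one steady state to the next.
\<close>

definition SD :: "nat \<Rightarrow> (nat \<Rightarrow> nat) \<Rightarrow> nat list list" where
  "SD n w =
     (let t = (SOME t. steady n ((bb n ^^ t) (perm_config n w)))
      in soliton_rows n ((bb n ^^ t) (perm_config n w)))"

text \<open>Row insertion returns the new row together with the bumped entry, if any.\<close>

fun row_insert :: "nat \<Rightarrow> nat list \<Rightarrow> nat list \<times> nat option" where
  "row_insert x [] = ([x], None)"
| "row_insert x (y # ys) =
     (if x < y then (x # ys, Some y)
      else (case row_insert x ys of (zs, b) \<Rightarrow> (y # zs, b)))"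

fun rs_insert :: "nat \<Rightarrow> nat list list \<Rightarrow> nat list list" where
  "rs_insert x [] = [[x]]"
| "rs_insert x (r # T) =
     (case row_insert x r of
        (r', None) \<Rightarrow> r' # T
      | (r', Some y) \<Rightarrow> r' # rs_insert y T)"

definition P_tableau :: "nat \<Rightarrow> (nat \<Rightarrow> nat) \<Rightarrow> nat list list" where
  "P_tableau n w = fold rs_insert (map w [1..<n + 1]) []"

end

theory Submission
  imports Defs "HOL-Library.Multiset"
begin

text \<open>
  One move of the box-ball system can be performed in a single sweep from left to right by a
  carrier, an increasing list of balls. At a box with ball \<open>x\<close> the carrier takes \<open>x\<close> in and drops
  the smallest carried ball larger than \<open>x\<close>, if there is one; at an empty box it drops its smallest
  ball. The first of these rules is row insertion, so on a permutation, which has no gaps, the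
  carrier ends the sweep as \<open>Row\<^sub>1(P(w))\<close>. It is then unloaded in increasing order into the empty
  boxes to the right of everything else (\<open>bb_config\<close>, \<open>carrier_eq_row1\<close>).

  The carrier is determined by its profile, the function that counts its balls of size at most
  \<open>v\<close>. Row insertion acts on profiles by a max-plus formula, and iterating the formula along a word
  gives the length of a longest increasing subsequence with entries at most \<open>v\<close>. Two things follow.
  Reading the balls of a configuration without the gaps, the resulting profile is unchanged by a
  move, because carrier operations are Knuth transformations of the word of balls
  (\<open>fold_lis_step_move\<close>). And gaps can only decrease the profile. Hence at a later time the profile of
  the final carrier is at most that of \<open>Row\<^sub>1(P(w))\<close>; it is also at least that, since the balls
  unloaded by the previous sweep are met last. So every sweep ends with the same carrier
  (\<open>carrier_move_funpow\<close>), and what it unloads is the rightmost increasing run.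

  That a steady state exists is proved for arbitrary configurations, gaps included, by induction on
  the number of balls (\<open>eventually_settled\<close>). The profiles of the final carriers increase with time
  and are bounded, so from some time on the final carrier is a fixed list \<open>R\<close>. Then the sweep
  over the boxes that hold \<open>R\<close> replaces all of the carrier by \<open>R\<close>; this forces the carrier to be
  unloaded there in increasing order, exactly as if those boxes were empty. The remaining balls
  therefore move as they would without \<open>R\<close>, and they never merge with \<open>R\<close> into a longer run.

  Finally, the ball in the last occupied box is always in \<open>R\<close>, as it is the last to enter the
  carrier. In a steady state its soliton is the rightmost one, and after one more move this soliton
  is the run \<open>R\<close>; so the first row of the soliton decomposition is \<open>R\<close> whichever steady state is
  chosen, the initial configuration included.
\<close>

section \<open>The carrier\<close>

text \<open>
  Balls only move to the right, so a configuration is a list filling the boxes \<open>1, 2, \<dots>\<close>, up to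
  trailing empty boxes. The letter \<open>e\<close> marks an empty box.
\<close>

definition config :: "nat \<Rightarrow> nat list \<Rightarrow> int \<Rightarrow> nat" where
  "config e xs p = (if 1 \<le> p \<and> p \<le> int (length xs) then xs ! nat (p - 1) else e)"

definition balls :: "nat \<Rightarrow> nat list \<Rightarrow> nat list" where
  "balls e xs = filter (\<lambda>x. x \<noteq> e) xs"

text \<open>
  \<open>load\<close> is the content of the carrier after it has passed a box with entry \<open>x\<close>, and \<open>unload\<close> the
  entry that it leaves in that box. An empty box acts as a letter smaller than all balls that is
  not itself taken in: it bumps the head of the carrier.
\<close>

definition load :: "nat \<Rightarrow> nat \<Rightarrow> nat list \<Rightarrow> nat list" where
  "load e x C = (if x = e then tl C else fst (row_insert x C))"

definition unload :: "nat \<Rightarrow> nat \<Rightarrow> nat list \<Rightarrow> nat" where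
  "unload e x C =
     (if x = e then (if C = [] then e else hd C)
      else (case snd (row_insert x C) of None \<Rightarrow> e | Some y \<Rightarrow> y))"

fun trail :: "nat \<Rightarrow> nat list \<Rightarrow> nat list \<Rightarrow> nat list" where
  "trail e C [] = []"
| "trail e C (x # xs) = unload e x C # trail e (load e x C) xs"

definition carrier :: "nat \<Rightarrow> nat list \<Rightarrow> nat list \<Rightarrow> nat list" where
  "carrier e C xs = fold (load e) xs C"

definition move :: "nat \<Rightarrow> nat list \<Rightarrow> nat list" where
  "move e xs = trail e [] xs @ carrier e [] xs"

lemma balls_simps [simp]:
  "balls e [] = []"
  "balls e (x # xs) = (if x = e then balls e xs else x # balls e xs)"
  "balls e (xs @ ys) = balls e xs @ balls e ys"
  "balls e (replicate j e) = []"
  by (auto simp: balls_def)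

lemma set_balls: "set (balls e xs) = set xs - {e}"
  by (auto simp: balls_def)

lemma balls_id: "e \<notin> set xs \<Longrightarrow> balls e xs = xs"
  by (induction xs) auto

lemma carrier_simps [simp]:
  "carrier e C [] = C"
  "carrier e C (x # xs) = carrier e (load e x C) xs"
  "carrier e C (xs @ ys) = carrier e (carrier e C xs) ys"
  by (simp_all add: carrier_def)

lemma trail_append [simp]: "trail e C (xs @ ys) = trail e C xs @ trail e (carrier e C xs) ys"
  by (induction xs arbitrary: C) auto

text \<open>
  Letters not exceeding the inserted one are inert; this lets a carrier be treated as a
  fixed lower part followed by the part in which all bumping takes place.
\<close>

lemma row_insert_append_max:
  "\<forall>c\<in>set P. c \<le> x \<Longrightarrow> row_insert x (P @ D) = (P @ fst (row_insert x D), snd (row_insert x D))"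
  by (induction P) (auto split: prod.splits)

lemma row_insert_cases:
  obtains (append) "\<forall>c\<in>set C. c \<le> x" "row_insert x C = (C @ [x], None)"
  | (bump) P y D where "C = P @ y # D" "\<forall>p\<in>set P. p \<le> x" "x < y"
      "row_insert x C = (P @ x # D, Some y)"
proof (cases "\<forall>c\<in>set C. c \<le> x")
  case True
  then show ?thesis using row_insert_append_max[of C x "[]"] append by simp
next
  case False
  then have "\<exists>y\<in>set C. x < y" by (auto simp: not_le)
  then obtain P y D where C: "C = P @ y # D" "x < y" "\<forall>p\<in>set P. \<not> x < p"
    by (rule split_list_first_propE)
  then have "\<forall>p\<in>set P. p \<le> x" by (auto simp: not_less)
  with C bump show ?thesis using row_insert_append_max[of P x "y # D"] by simp
qed

lemma sorted_load: "sorted C \<Longrightarrow> sorted (load e x C)"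
proof (cases "x = e")
  case True
  then show "sorted C \<Longrightarrow> ?thesis" by (simp add: load_def sorted_tl)
next
  case False
  assume "sorted C"
  then show ?thesis using False
    by (cases rule: row_insert_cases[of C x]) (fastforce simp: load_def sorted_append)+
qed

lemma set_load: "set (load e x C) \<subseteq> set C \<union> ({x} - {e})"
proof (cases "x = e")
  case True
  then show ?thesis by (cases C) (auto simp: load_def)
next
  case False
  then show ?thesis by (cases rule: row_insert_cases[of C x]) (auto simp: load_def)
qed

lemma sorted_carrier: "sorted C \<Longrightarrow> sorted (carrier e C xs)"
  by (induction xs arbitrary: C) (auto simp: sorted_load)

lemma set_carrier: "set (carrier e C xs) \<subseteq> set C \<union> set (balls e xs)"
proof (induction xs arbitrary: C)
  case (Cons x xs)
  then show ?case using set_load[of e x C] Cons[of "load e x C"] by (auto split: if_splits)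
qed simp

lemma empty_notin_carrier: "e \<notin> set C \<Longrightarrow> e \<notin> set (carrier e C xs)"
  using set_carrier[of e C xs] by (auto simp: set_balls)

lemma mset_load_unload:
  assumes "e \<notin> set C"
  shows "mset (balls e [unload e x C]) + mset (load e x C) = mset C + mset (balls e [x])"
proof (cases "x = e")
  case True
  then show ?thesis using assms by (cases C) (auto simp: load_def unload_def)
next
  case False
  then show ?thesis using assms
    by (cases rule: row_insert_cases[of C x]) (auto simp: load_def unload_def)
qed
text \<open>
  This keeps the balls of a configuration distinct over time, which strict runs and jumps rely on.
\<close>

lemma mset_trail_carrier:
  "e \<notin> set C \<Longrightarrow> mset (balls e (trail e C xs)) + mset (carrier e C xs) = mset C + mset (balls e xs)"
proof (induction xs arbitrary: C)
  case (Cons x xs)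
  have "e \<notin> set (load e x C)" using set_load[of e x C] Cons.prems by auto
  have "mset (balls e (trail e C (x # xs))) + mset (carrier e C (x # xs))
      = mset (balls e [unload e x C]) +
        (mset (balls e (trail e (load e x C) xs)) + mset (carrier e (load e x C) xs))"
    by simp
  also have "\<dots> = (mset (balls e [unload e x C]) + mset (load e x C)) + mset (balls e xs)"
    using Cons.IH[OF \<open>e \<notin> set (load e x C)\<close>] by (simp add: union_assoc)
  also have "\<dots> = mset C + mset (balls e (x # xs))"
    using mset_load_unload[OF Cons.prems, of x] by simp
  finally show ?case .
qed simp

lemma mset_balls_move: "mset (balls e (move e xs)) = mset (balls e xs)"
  using mset_trail_carrier[of e "[]" xs] empty_notin_carrier[of e "[]" xs]
  by (simp add: move_def balls_id)

section \<open>Profiles of carriers\<close>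

definition count_le :: "nat list \<Rightarrow> nat \<Rightarrow> nat" where
  "count_le C v = length (filter (\<lambda>c. c \<le> v) C)"

text \<open>
  If \<open>f v\<close> is the length of a longest weakly increasing subsequence of a word with entries at most \<open>v\<close>, then
  \<open>lis_step x f\<close> is the same function for the word extended by \<open>x\<close>: a new subsequence either avoids
  the last letter or appends it to one with entries at most \<open>x\<close>.
\<close>

definition lis_step :: "nat \<Rightarrow> (nat \<Rightarrow> nat) \<Rightarrow> nat \<Rightarrow> nat" where
  "lis_step x f v = (if x \<le> v then max (f v) (Suc (f x)) else f v)"

definition carrier_step :: "nat \<Rightarrow> nat \<Rightarrow> (nat \<Rightarrow> nat) \<Rightarrow> nat \<Rightarrow> nat" where
  "carrier_step e x f = (if x = e then (\<lambda>v. f v - 1) else lis_step x f)"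

lemma count_le_simps [simp]:
  "count_le [] v = 0" "count_le (c # C) v = (if c \<le> v then Suc (count_le C v) else count_le C v)"
  by (auto simp: count_le_def)

lemma count_le_eq_0: "\<forall>c\<in>set C. v < c \<Longrightarrow> count_le C v = 0"
  by (induction C) auto

text \<open>
  Insertion of \<open>x\<close> in place of the next larger \<open>y\<close> raises the profile by one exactly on \<open>[x, y)\<close>. There
  the profile still has its value at \<open>x\<close>, so this is what the maximum in \<open>lis_step\<close> does.
\<close>

lemma count_le_row_insert:
  "sorted C \<Longrightarrow> count_le (fst (row_insert x C)) = lis_step x (count_le C)"
proof (induction C)
  case (Cons y C)
  show ?case
  proof (cases "x < y")
    case True
    then have "count_le C v = 0" if "v < y" for v
      using Cons.prems that by (intro count_le_eq_0) auto
    then show ?thesis using True by (auto simp: lis_step_def fun_eq_iff)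
  next
    case False
    then show ?thesis using Cons by (auto simp: lis_step_def fun_eq_iff split: prod.splits)
  qed
qed (auto simp: lis_step_def fun_eq_iff)

lemma count_le_load: "sorted C \<Longrightarrow> count_le (load e x C) = carrier_step e x (count_le C)"
proof (cases "x = e")
  case True
  assume "sorted C"
  then have "count_le (tl C) v = count_le C v - 1" for v
    using count_le_eq_0[of "tl C" v] by (cases C) force+
  then show ?thesis using True by (auto simp: load_def carrier_step_def)
qed (simp add: load_def carrier_step_def count_le_row_insert)

lemma count_le_carrier: "sorted C \<Longrightarrow> count_le (carrier e C xs) = fold (carrier_step e) xs (count_le C)"
  by (induction xs arbitrary: C) (auto simp: count_le_load sorted_load)

lemma count_le_inject:
  "sorted C \<Longrightarrow> sorted D \<Longrightarrow> count_le C = count_le D \<Longrightarrow> C = D"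
proof (induction C arbitrary: D)
  case Nil
  then show ?case by (cases D) (auto dest: fun_cong[of _ _ "hd D"])
next
  case (Cons c C)
  show ?case
  proof (cases D)
    case Nil
    then show ?thesis using fun_cong[OF Cons.prems(3), of c] by simp
  next
    case (Cons d D')
    have eq: "count_le (c # C) v = count_le (d # D') v" for v
      using fun_cong[OF Cons.prems(3), of v] Cons by (simp only:)
    have "c = d"
    proof (rule linorder_cases[of c d])
      assume "c < d"
      then have "count_le D' c = 0" using \<open>sorted D\<close> Cons by (intro count_le_eq_0) auto
      then show ?thesis using eq[of c] \<open>c < d\<close> by simp
    next
      assume "d < c"
      then have "count_le C d = 0" using \<open>sorted (c # C)\<close> by (intro count_le_eq_0) auto
      then show ?thesis using eq[of d] \<open>d < c\<close> by simp
    qed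
    moreover have "count_le C = count_le D'"
    proof
      fix v show "count_le C v = count_le D' v" using eq[of v] \<open>c = d\<close> \<open>sorted (c # C)\<close> \<open>sorted D\<close> Cons
          count_le_eq_0[of C v] count_le_eq_0[of D' v] by (cases "c \<le> v") force+
    qed
    ultimately show ?thesis using Cons.IH[of D'] Cons.prems Cons by simp
  qed
qed

lemma lis_step_mono: "f \<le> g \<Longrightarrow> lis_step x f \<le> lis_step x g"
  by (auto simp: lis_step_def le_fun_def max.coboundedI1 max.coboundedI2)

lemma carrier_step_mono: "f \<le> g \<Longrightarrow> carrier_step e x f \<le> carrier_step e x g"
  using lis_step_mono[of f g x] by (auto simp: carrier_step_def le_fun_def diff_le_mono)

lemma fold_carrier_step_mono: "f \<le> g \<Longrightarrow> fold (carrier_step e) xs f \<le> fold (carrier_step e) xs g"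
  by (induction xs arbitrary: f g) (auto simp: carrier_step_mono)

lemma fold_lis_step_mono: "f \<le> g \<Longrightarrow> fold lis_step xs f \<le> fold lis_step xs g"
  by (induction xs arbitrary: f g) (auto simp: lis_step_mono)

lemma fold_lis_step_increasing: "f \<le> fold lis_step xs f"
proof (induction xs arbitrary: f)
  case (Cons x xs)
  have "f \<le> lis_step x f" by (auto simp: lis_step_def le_fun_def)
  then show ?case using Cons[of "lis_step x f"] by (auto intro: order_trans)
qed simp

lemma fold_carrier_step_eq_lis_step: "e \<notin> set xs \<Longrightarrow> fold (carrier_step e) xs f = fold lis_step xs f"
  by (induction xs arbitrary: f) (auto simp: carrier_step_def)

text \<open>
  Gaps only cost the carrier balls, and \<open>lis_step\<close> is monotone in the profile, so a word with gaps has
  at most the profile of its balls.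
\<close>

lemma fold_carrier_step_le_lis_step: "fold (carrier_step e) xs f \<le> fold lis_step (balls e xs) f"
proof (induction xs arbitrary: f)
  case (Cons x xs)
  have "(\<lambda>v. f v - 1) \<le> f" by (auto simp: le_fun_def)
  then show ?case
    using Cons[of "carrier_step e x f"] fold_lis_step_mono[of "\<lambda>v. f v - 1" f "balls e xs"]
    by (auto simp: carrier_step_def intro: order_trans)
qed simp

lemma count_le_Nil: "count_le [] = (\<lambda>_. 0)" by auto

lemma carrier_sorted:
  assumes "sorted R" "e \<notin> set R" shows "carrier e [] R = R"
proof -
  have "carrier e P R = P @ R" if "sorted (P @ R)" for P
    using that assms(2)
  proof (induction R arbitrary: P)
    case (Cons r R)
    then have "load e r P = P @ [r]"
      using row_insert_append_max[of P r "[]"] by (auto simp: load_def sorted_append)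
    then show ?case using Cons.IH[of "P @ [r]"] Cons.prems by simp
  qed simp
  from this[of "[]"] assms show ?thesis by simp
qed

text \<open>
  By monotonicity in the initial profile, the carrier reached from \<open>C\<close> dominates the one reached
  from the empty carrier, and the latter is \<open>R\<close> itself.
\<close>

lemma count_le_carrier_ge:
  assumes "sorted C" "sorted R" "e \<notin> set R"
  shows "count_le R \<le> count_le (carrier e C R)"
proof -
  have "count_le R = fold (carrier_step e) R (\<lambda>_. 0)"
    using count_le_carrier[of "[]" e R] carrier_sorted[OF assms(2,3)] by (simp add: count_le_Nil)
  also have "\<dots> \<le> fold (carrier_step e) R (count_le C)" by (rule fold_carrier_step_mono) (simp add: le_fun_def)
  also have "\<dots> = count_le (carrier e C R)" using count_le_carrier[OF assms(1)] by simp
  finally show ?thesis .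
qed

section \<open>Knuth invariance of the word of balls\<close>

lemma mono_lis_step: "mono f \<Longrightarrow> mono (lis_step x f)"
  unfolding mono_def lis_step_def by (auto simp: max.coboundedI1 max.coboundedI2 intro: le_SucI)

lemma mono_fold_lis_step: "mono f \<Longrightarrow> mono (fold lis_step xs f)"
  by (induction xs arbitrary: f) (auto simp: mono_lis_step)

text \<open>
  The two Knuth relations \<open>y x z = y z x\<close> and \<open>x z y = z x y\<close> hold for the operators on monotone
  profiles: the two sides have the same increasing subsequences, apart from \<open>x z\<close> in the first and
  \<open>x z\<close> in the second, and these are dominated by \<open>y z\<close> and \<open>x y\<close> respectively.
\<close>

lemma lis_step_knuth_yxz:
  assumes "mono f" "x < y" "y \<le> z"
  shows "lis_step z (lis_step x (lis_step y f)) = lis_step x (lis_step z (lis_step y f))"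
proof
  fix v
  have "f x \<le> f y" "f y \<le> f z" using assms by (auto simp: mono_def)
  moreover have "z \<le> v \<Longrightarrow> f z \<le> f v" using assms by (auto simp: mono_def)
  ultimately show "lis_step z (lis_step x (lis_step y f)) v = lis_step x (lis_step z (lis_step y f)) v"
    using assms(2,3) by (simp add: lis_step_def max_def)
qed

lemma lis_step_knuth_xzy:
  assumes "mono f" "x \<le> y" "y < z"
  shows "lis_step y (lis_step z (lis_step x f)) = lis_step y (lis_step x (lis_step z f))"
proof
  fix v
  have "f x \<le> f y" "f y \<le> f z" using assms by (auto simp: mono_def)
  moreover have "z \<le> v \<Longrightarrow> f z \<le> f v" "y \<le> v \<Longrightarrow> f y \<le> f v" using assms by (auto simp: mono_def)
  ultimately show "lis_step y (lis_step z (lis_step x f)) v = lis_step y (lis_step x (lis_step z f)) v"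
    using assms(2,3) by (simp add: lis_step_def max_def)
qed

text \<open>
  Together with \<open>lis_step_bump_left\<close> this turns the word \<open>P y D x\<close> (a carrier followed by the letter
  read) into \<open>y P x D\<close> (the letter bumped, followed by the new carrier): first \<open>x\<close> travels left
  through \<open>D\<close>, then \<open>y\<close> travels left through \<open>P\<close>.
\<close>

lemma lis_step_move_left:
  "mono f \<Longrightarrow> sorted (y # D) \<Longrightarrow> x < y \<Longrightarrow>
   fold lis_step (y # D @ [x]) f = fold lis_step (y # x # D) f"
proof (induction D arbitrary: y f)
  case (Cons d D)
  have "fold lis_step (y # (d # D) @ [x]) f = fold lis_step (d # D @ [x]) (lis_step y f)" by simp
  also have "\<dots> = fold lis_step (d # x # D) (lis_step y f)"
    using Cons.prems by (intro Cons.IH mono_lis_step) auto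
  also have "\<dots> = fold lis_step (y # x # d # D) f"
    using lis_step_knuth_yxz[of f x y d] Cons.prems by simp
  finally show ?case .
qed simp

lemma lis_step_bump_left:
  "mono f \<Longrightarrow> sorted (P @ [x]) \<Longrightarrow> x < y \<Longrightarrow>
   fold lis_step (P @ [y, x]) f = fold lis_step (y # P @ [x]) f"
proof (induction P arbitrary: f)
  case (Cons p P)
  obtain q Q where Q: "P @ [x] = q # Q" by (cases "P @ [x]") auto
  have "p \<le> q" "q < y"
    using Cons.prems Q by (cases P; auto)+
  have "fold lis_step ((p # P) @ [y, x]) f = fold lis_step (y # P @ [x]) (lis_step p f)"
    using Cons.prems by (simp add: Cons.IH mono_lis_step del: fold_append)
  also have "\<dots> = fold lis_step (y # (p # P) @ [x]) f"
    using lis_step_knuth_xzy[of f p q y] Cons.prems(1) \<open>p \<le> q\<close> \<open>q < y\<close> by (simp add: Q del: fold_append)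
  finally show ?case .
qed simp

text \<open>
  At an empty box the carrier only sheds its first letter, which does not change the concatenation
  of the letter left behind and the carrier.
\<close>

lemma fold_lis_step_load_unload:
  assumes "mono f" "sorted C" "e \<notin> set C"
  shows "fold lis_step (balls e [unload e x C] @ load e x C) f = fold lis_step (C @ balls e [x]) f"
proof (cases "x = e")
  case True
  then show ?thesis using assms(3) by (cases C) (auto simp: load_def unload_def)
next
  case False
  show ?thesis
  proof (cases rule: row_insert_cases[of C x])
    case append
    then show ?thesis using False by (auto simp: load_def unload_def)
  next
    case (bump P y D)
    have P: "sorted (P @ [x])" "sorted (y # D)" "y \<noteq> e"
      using bump assms(2,3) by (auto simp: sorted_append)
    have "fold lis_step (C @ [x]) f = fold lis_step (y # D @ [x]) (fold lis_step P f)"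
      using bump by simp
    also have "\<dots> = fold lis_step D (fold lis_step (P @ [y, x]) f)"
      using lis_step_move_left[of "fold lis_step P f" y D x] P(2) bump(3) mono_fold_lis_step[OF assms(1)] by simp
    also have "\<dots> = fold lis_step (y # P @ x # D) f"
      using lis_step_bump_left[OF assms(1) P(1) bump(3)] by simp
    finally show ?thesis using False bump P by (simp add: load_def unload_def)
  qed
qed

lemma fold_lis_step_trail_carrier:
  "mono f \<Longrightarrow> sorted C \<Longrightarrow> e \<notin> set C \<Longrightarrow>
   fold lis_step (balls e (trail e C xs) @ carrier e C xs) f = fold lis_step (C @ balls e xs) f"
proof (induction xs arbitrary: C f)
  case (Cons x xs)
  let ?y = "unload e x C" and ?D = "load e x C"
  have D: "sorted ?D" "e \<notin> set ?D"
    using sorted_load set_load[of e x C] Cons.prems by auto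
  have "fold lis_step (balls e (trail e C (x # xs)) @ carrier e C (x # xs)) f
      = fold lis_step (balls e (trail e ?D xs) @ carrier e ?D xs) (fold lis_step (balls e [?y]) f)"
    by simp
  also have "\<dots> = fold lis_step (?D @ balls e xs) (fold lis_step (balls e [?y]) f)"
    by (intro Cons.IH mono_fold_lis_step Cons.prems D)
  also have "\<dots> = fold lis_step (balls e xs) (fold lis_step (balls e [?y] @ ?D) f)" by simp
  also have "\<dots> = fold lis_step (C @ balls e (x # xs)) f"
    using fold_lis_step_load_unload[OF Cons.prems(1-3), of x] by simp
  finally show ?case .
qed simp

lemma fold_lis_step_move: "mono f \<Longrightarrow> fold lis_step (balls e (move e xs)) f = fold lis_step (balls e xs) f"
  using fold_lis_step_trail_carrier[of f "[]" e xs] empty_notin_carrier[of e "[]" xs]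
  by (simp add: move_def balls_id)

section \<open>The carrier performs the jumps\<close>

text \<open>
  The jump of a single ball \<open>k\<close> as a left-to-right sweep: \<open>b\<close> tells whether \<open>k\<close> has been picked up and
  not yet been put down.
\<close>

fun pass :: "nat \<Rightarrow> nat \<Rightarrow> bool \<Rightarrow> nat list \<Rightarrow> nat list" where
  "pass e k b [] = (if b then [k] else [])"
| "pass e k b (x # xs) =
     (if b \<and> x = e then k # pass e k False xs
      else if x = k then e # pass e k True xs
      else x # pass e k b xs)"

text \<open>
  The carrier sweep restricted to the balls \<open>1, \<dots>, k\<close>; larger balls are obstacles that are left where
  they are. It interpolates between doing nothing and a full move, one ball at a time.
\<close>

fun sweep :: "nat \<Rightarrow> nat \<Rightarrow> nat list \<Rightarrow> nat list \<Rightarrow> nat list" where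
  "sweep e k C [] = C"
| "sweep e k C (x # xs) =
     (if k < x \<and> x \<noteq> e then x # sweep e k C xs
      else unload e x C # sweep e k (load e x C) xs)"

lemma sweep_0: "0 \<notin> set xs \<Longrightarrow> sweep e 0 [] xs = xs"
  by (induction xs) (auto simp: load_def unload_def)

lemma sweep_all: "set xs \<subseteq> {..Suc n} \<Longrightarrow> sweep (Suc n) n C xs = trail (Suc n) C xs @ carrier (Suc n) C xs"
  by (induction xs arbitrary: C) auto

lemma pass_no_ball: "k \<notin> set xs \<Longrightarrow> pass e k False xs = xs"
  by (induction xs) auto

lemma pass_carried: "k \<notin> set C \<Longrightarrow> e \<notin> set C \<Longrightarrow> pass e k b C = (if b then C @ [k] else C)"
  by (induction C) auto

text \<open>
  The sweep for \<open>1, \<dots>, k\<close> followed by the jump of \<open>k + 1\<close> is the sweep for \<open>1, \<dots>, k + 1\<close>. Both can be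
  run simultaneously: the ball \<open>k + 1\<close>, while in flight, is the largest entry of the joint carrier, so
  it is put down just when the smaller carrier leaves a box empty.
\<close>

lemma pass_sweep:
  assumes "set C \<subseteq> {..k}" "Suc k < e" "distinct (balls e xs)" "b \<longrightarrow> Suc k \<notin> set xs"
  shows "pass e (Suc k) b (sweep e k C xs) = sweep e (Suc k) (C @ (if b then [Suc k] else [])) xs"
  using assms
proof (induction xs arbitrary: C b)
  case Nil
  then have "Suc k \<notin> set C" "e \<notin> set C" by fastforce+
  then show ?case using pass_carried[of "Suc k" C e b] by simp
next
  case (Cons x xs)
  let ?K = "if b then [Suc k] else []"
  consider "x = e" | "x \<noteq> e" "Suc k < x" | "x = Suc k" "x \<noteq> e" | "x \<le> k" "x \<noteq> e" by linarith
  then show ?case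
  proof cases
    case 1
    show ?thesis
    proof (cases C)
      case Nil
      then show ?thesis using 1 Cons.prems Cons.IH[of "[]" False]
        by (auto simp: load_def unload_def)
    next
      case (Cons c C')
      have "c < Suc k" "c \<noteq> e" "set C' \<subseteq> {..k}" using Cons Cons.prems by auto
      then show ?thesis using 1 Cons.prems Cons.IH[of C' b] Cons
        by (auto simp: load_def unload_def)
    qed
  next
    case 2
    then show ?thesis using Cons.prems Cons.IH[of C b] by auto
  next
    case 3
    then have "\<not> b" "Suc k \<notin> set xs" using Cons.prems by (auto simp: set_balls)
    moreover have "row_insert (Suc k) C = (C @ [Suc k], None)"
      using row_insert_append_max[of C "Suc k" "[]"] Cons.prems by fastforce
    ultimately show ?thesis using 3 Cons.prems Cons.IH[of C True]
      by (auto simp: load_def unload_def)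
  next
    case 4
    have load: "set (load e x C) \<subseteq> {..k}" using set_load[of e x C] Cons.prems(1) 4 by auto
    show ?thesis
    proof (cases rule: row_insert_cases[of C x])
      case append
      have "row_insert x (C @ [Suc k]) = (C @ [x], Some (Suc k))"
        using append(1) 4 row_insert_append_max[of C x "[Suc k]"] by simp
      then show ?thesis using append(2) load 4 Cons.prems Cons.IH[of "C @ [x]" False]
        by (auto simp: load_def unload_def)
    next
      case (bump P y D)
      have "row_insert x (C @ ?K) = (P @ x # D @ ?K, Some y)"
        using bump row_insert_append_max[of P x "y # D @ ?K"] by simp
      moreover have "y \<le> k" "y \<noteq> e" using bump Cons.prems by auto
      ultimately show ?thesis using bump load 4 Cons.prems Cons.IH[of "P @ x # D" b]
        by (auto simp: load_def unload_def)
    qed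
  qed
qed

lemma mset_sweep:
  "e \<notin> set C \<Longrightarrow> mset (balls e (sweep e k C xs)) = mset C + mset (balls e xs)"
proof (induction xs arbitrary: C)
  case Nil
  then show ?case by (simp add: balls_id)
next
  case (Cons x xs)
  have "e \<notin> set (load e x C)" using set_load[of e x C] Cons.prems by auto
  then have "mset (balls e (unload e x C # sweep e k (load e x C) xs))
      = (mset (balls e [unload e x C]) + mset (load e x C)) + mset (balls e xs)"
    using Cons.IH[of "load e x C"] by simp
  also have "\<dots> = mset C + mset (balls e (x # xs))"
    using mset_load_unload[OF Cons.prems, of x] by simp
  finally show ?case using Cons.IH[OF Cons.prems] by (cases "x = e") auto
qed

lemma config_append_empty: "config e (xs @ replicate j e) = config e xs"
  by (auto simp: config_def fun_eq_iff nth_append)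

lemma config_update:
  "i < length xs \<Longrightarrow> config e (xs[i := v]) = (config e xs)(int i + 1 := v)"
  by (auto simp: config_def fun_eq_iff nth_list_update)

lemma config_nth: "i < length xs \<Longrightarrow> config e xs (int i + 1) = xs ! i"
  by (auto simp: config_def)

lemma config_eqD:
  assumes "config e xs p = k" "k \<noteq> e"
  obtains i where "i < length xs" "p = int i + 1" "xs ! i = k"
  using assms that[of "nat (p - 1)"] by (auto simp: config_def split: if_splits)

lemma jump_config:
  assumes k: "k \<notin> set us" "k \<notin> set as" "k \<notin> set bs" "k \<noteq> Suc n" and "Suc n \<notin> set as"
  shows "jump n k (config (Suc n) (us @ k # as @ Suc n # bs)) = config (Suc n) (us @ Suc n # as @ k # bs)"
proof -
  let ?e = "Suc n"
  let ?xs = "us @ k # as @ ?e # bs"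
  let ?i = "length us" and ?j = "length us + 1 + length as"
  have nth: "?xs ! i = (if i < ?i then us ! i else if i = ?i then k else if i < ?j then as ! (i - ?i - 1)
     else if i = ?j then ?e else bs ! (i - ?j - 1))" for i
    by (auto simp: nth_append nth_Cons' )
  have p: "(THE p. config ?e ?xs p = k) = int ?i + 1"
  proof (rule the_equality)
    show "config ?e ?xs (int ?i + 1) = k" by (subst config_nth) auto
    fix p assume "config ?e ?xs p = k"
    then obtain i where i: "i < length ?xs" "p = int i + 1" "?xs ! i = k"
      using k(4) by (rule config_eqD)
    consider "i < ?i" | "i = ?i" | "?i < i" "i < ?j" | "i = ?j" | "?j < i" by linarith
    then have "i = ?i"
    proof cases
      case 1
      then show ?thesis using i(3) k(1) nth[of i] by (metis nth_mem)
    next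
      case 3
      then have "i - ?i - 1 < length as" by simp
      then have "as ! (i - ?i - 1) \<noteq> k" using k(2) by (metis nth_mem)
      then show ?thesis using i(3) nth[of i] 3 by simp
    next
      case 4
      then show ?thesis using i(3) nth[of i] k(4) by simp
    next
      case 5
      then have "i - ?j - 1 < length bs" using i(1) by simp
      then have "bs ! (i - ?j - 1) \<noteq> k" using k(3) by (metis nth_mem)
      then show ?thesis using i(3) nth[of i] 5 by simp
    qed
    then show "p = int ?i + 1" using i(2) by simp
  qed
  have q: "(LEAST q. int ?i + 1 < q \<and> config ?e ?xs q = n + 1) = int ?j + 1"
  proof (rule Least_equality)
    show "int ?i + 1 < int ?j + 1 \<and> config ?e ?xs (int ?j + 1) = n + 1"
      by (subst config_nth) (auto simp: nth)
    fix q assume q: "int ?i + 1 < q \<and> config ?e ?xs q = n + 1"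
    show "int ?j + 1 \<le> q"
    proof (rule ccontr)
      assume less: "\<not> ?thesis"
      define i where "i = nat (q - 1)"
      have i: "?i < i" "i < ?j" "q = int i + 1" using q less by (auto simp: i_def)
      then have "i < length ?xs" by simp
      then have "as ! (i - ?i - 1) = ?e" using q i nth[of i] config_nth[of i ?xs ?e] by simp
      moreover have "i - ?i - 1 < length as" using i by simp
      ultimately show False using assms(5) by (metis nth_mem)
    qed
  qed
  have "us @ ?e # as @ k # bs = ?xs[?i := ?e, ?j := k]"
    by (simp add: list_update_append)
  then show ?thesis unfolding jump_def p Let_def q
    using config_update[of ?i ?xs ?e ?e] config_update[of ?j "?xs[?i := ?e]" ?e k] by simp
qed

lemma config_pass:
  assumes "k \<in> set xs" "k \<noteq> Suc n" "distinct (balls (Suc n) xs)"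
  shows "config (Suc n) (pass (Suc n) k False xs) = jump n k (config (Suc n) xs)"
proof -
  let ?e = "Suc n"
  obtain us vs where xs: "xs = us @ k # vs" "k \<notin> set us" using split_list_first[OF assms(1)] by blast
  have "k \<notin> set vs" using assms(2,3) xs by (auto simp: set_balls)
  have start: "pass ?e k False (us @ k # vs) = us @ ?e # pass ?e k True vs"
    using xs(2) by (induction us) auto
  \<comment> \<open>the appended empty box guarantees that the ball finds a place to land\<close>
  obtain as bs where vs: "vs @ [?e] = as @ ?e # bs" "?e \<notin> set as"
    using split_list_first[of ?e "vs @ [?e]"] by auto
  have notin: "k \<notin> set as" "k \<notin> set bs"
    using arg_cong[OF vs(1), of set] \<open>k \<notin> set vs\<close> assms(2) by auto
  have carry: "pass ?e k True (as @ ?e # ws) = as @ k # ws" if "k \<notin> set ws" for ws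
    using notin(1) vs(2) that by (induction as) (auto simp: pass_no_ball assms(2))
  have "config ?e (pass ?e k False xs) = config ?e (us @ ?e # as @ k # bs)"
  proof (cases bs rule: rev_cases)
    case Nil
    then have "pass ?e k True vs = as @ [k]"
      using vs notin(1) pass_carried[of k as ?e True] by simp
    then show ?thesis using xs(1) start Nil by simp
  next
    case (snoc bs' b)
    then have "b = ?e" "vs = as @ ?e # bs'" using vs(1) by auto
    then have "pass ?e k False xs = us @ ?e # as @ k # bs'"
      using carry[of bs'] notin(2) snoc xs(1) start by simp
    then show ?thesis
      using config_append_empty[of ?e "us @ ?e # as @ k # bs'" 1] snoc \<open>b = ?e\<close> by simp
  qed
  also have "\<dots> = jump n k (config ?e (us @ k # as @ ?e # bs))"
    using jump_config[of k us as bs n] xs(2) notin assms(2) vs(2) by simp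
  also have "us @ k # as @ ?e # bs = xs @ replicate 1 ?e" using vs(1) xs(1) by simp
  finally show ?thesis by (simp only: config_append_empty)
qed

theorem bb_config:
  assumes balls: "distinct (balls (Suc n) xs)" "set (balls (Suc n) xs) = {1..n}"
  shows "bb n (config (Suc n) xs) = config (Suc n) (move (Suc n) xs)"
proof -
  let ?e = "Suc n"
  have "set xs \<subseteq> insert ?e (set (balls ?e xs))" by (auto simp: set_balls)
  then have "set xs \<subseteq> insert ?e {1..n}" by (simp only: balls(2))
  then have set: "0 \<notin> set xs" "set xs \<subseteq> {..?e}" by fastforce+
  have "fold (jump n) [1..<Suc k] (config ?e xs) = config ?e (sweep ?e k [] xs)" if "k \<le> n" for k
    using that
  proof (induction k)
    case 0
    then show ?case using sweep_0[OF set(1)] by simp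
  next
    case (Suc k)
    let ?ys = "sweep ?e k [] xs"
    have m: "mset (balls ?e ?ys) = mset (balls ?e xs)" by (simp add: mset_sweep)
    then have "Suc k \<in> set (balls ?e ?ys)" "distinct (balls ?e ?ys)"
      using Suc.prems balls mset_eq_setD[OF m] mset_eq_imp_distinct_iff[OF m] by simp_all
    then have "jump n (Suc k) (config ?e ?ys) = config ?e (pass ?e (Suc k) False ?ys)"
      using Suc.prems by (subst config_pass) (auto simp: set_balls)
    also have "\<dots> = config ?e (sweep ?e (Suc k) [] xs)"
      using pass_sweep[of "[]" k ?e xs False] Suc.prems balls(1) by simp
    finally show ?case using Suc by simp
  qed
  from this[of n] show ?thesis
    using sweep_all[OF set(2), of "[]"] by (simp add: bb_def move_def)
qed

section \<open>Increasing runs of configurations\<close>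

lemma strict_mono_on_int_iff:
  fixes X :: "int \<Rightarrow> nat"
  shows "strict_mono_on {a..b} X \<longleftrightarrow> (\<forall>i. a \<le> i \<and> i < b \<longrightarrow> X i < X (i + 1))"
proof
  assume step: "\<forall>i. a \<le> i \<and> i < b \<longrightarrow> X i < X (i + 1)"
  have "X p < X q" if "a \<le> p" "p < q" "q \<le> b" for p q
    using that(2,3)
  proof (induction q rule: int_gr_induct)
    case base
    then show ?case using step that(1) by simp
  next
    case (step i)
    then show ?case using \<open>\<forall>i. a \<le> i \<and> i < b \<longrightarrow> X i < X (i + 1)\<close> that(1)
      by (smt (verit) less_trans)
  qed
  then show "strict_mono_on {a..b} X" by (auto simp: strict_mono_on_def)
qed (auto simp: strict_mono_on_def)

lemma increasing_block_iff:
  "increasing_block n X a b \<longleftrightarrow>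
     a \<le> b \<and> (\<forall>p. a \<le> p \<and> p \<le> b \<longrightarrow> X p \<in> {1..n}) \<and> (\<forall>i. a \<le> i \<and> i < b \<longrightarrow> X i < X (i + 1))"
  unfolding increasing_block_def strict_mono_on_int_iff by auto

lemma increasing_block_union:
  assumes "increasing_block n X a b" "increasing_block n X a' b'" "a \<le> b'" "a' \<le> b"
  shows "increasing_block n X (min a a') (max b b')"
proof -
  have "X p \<in> {1..n}" if "min a a' \<le> p" "p \<le> max b b'" for p
  proof -
    have "(a \<le> p \<and> p \<le> b) \<or> (a' \<le> p \<and> p \<le> b')" using that assms(3,4) by linarith
    then show ?thesis using assms(1,2) unfolding increasing_block_iff by blast
  qed
  moreover have "X i < X (i + 1)" if "min a a' \<le> i" "i < max b b'" for i
  proof -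
    have "(a \<le> i \<and> i < b) \<or> (a' \<le> i \<and> i < b')" using that assms(3,4) by linarith
    then show ?thesis using assms(1,2) unfolding increasing_block_iff by blast
  qed
  moreover have "min a a' \<le> max b b'" using assms(1) by (auto simp: increasing_block_iff)
  ultimately show ?thesis unfolding increasing_block_iff by blast
qed

text \<open>
  Overlapping blocks can be glued, so distinct maximal ones are disjoint.
\<close>

lemma run_interval_overlap:
  assumes "run_interval n X a b" "run_interval n X a' b'" "a \<le> b'" "a' \<le> b"
  shows "a = a' \<and> b = b'"
proof -
  have "increasing_block n X (min a a') (max b b')"
    using assms by (intro increasing_block_union) (auto simp: run_interval_def)
  then have "min a a' = a \<and> max b b' = b" "min a a' = a' \<and> max b b' = b'"
    using assms(1,2) unfolding run_interval_def
    by (metis atLeastatMost_subset_iff max.cobounded1 max.cobounded2 min.cobounded1 min.cobounded2)+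
  then show ?thesis by linarith
qed

lemma run_interval_unique_end: "run_interval n X a b \<Longrightarrow> run_interval n X a b' \<Longrightarrow> b = b'"
  using run_interval_overlap[of n X a b a b']
  by (auto simp: run_interval_def increasing_block_iff)

lemma config_append_left: "p \<le> int (length ys) \<Longrightarrow> config e (ys @ R) p = config e ys p"
  by (auto simp: config_def nth_append)

lemma config_ball_bounds: "config (Suc n) xs p \<in> {1..n} \<Longrightarrow> 1 \<le> p \<and> p \<le> int (length xs)"
  by (auto simp: config_def split: if_splits)

lemma run_interval_bounds:
  assumes "run_interval n (config (Suc n) xs) a b"
  shows "1 \<le> a" "a \<le> b" "b \<le> int (length xs)"
proof -
  have "a \<le> b" "config (Suc n) xs a \<in> {1..n}" "config (Suc n) xs b \<in> {1..n}"
    using assms by (auto simp: run_interval_def increasing_block_iff)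
  then show "1 \<le> a" "a \<le> b" "b \<le> int (length xs)"
    using config_ball_bounds by blast+
qed

text \<open>
  The condition that no increasing block of \<open>ys @ R\<close> can cross the border between \<open>ys\<close> and \<open>R\<close>, when
  \<open>R\<close> is a nonempty list of balls: at the border there is an empty box or a descent.
\<close>

definition separated :: "nat \<Rightarrow> nat list \<Rightarrow> nat list \<Rightarrow> bool" where
  "separated e ys R \<longleftrightarrow> (ys = [] \<or> last ys = e \<or> hd R < last ys)"

lemma block_separated:
  assumes "increasing_block n (config (Suc n) (ys @ R)) a b" "separated (Suc n) ys R" "R \<noteq> []"
  shows "b \<le> int (length ys) \<or> int (length ys) < a"
proof (rule ccontr)
  assume not: "\<not> ?thesis"
  let ?l = "int (length ys)" and ?X = "config (Suc n) (ys @ R)"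
  have l: "?X ?l \<in> {1..n}" "?X ?l < ?X (?l + 1)" "1 \<le> a"
    using not assms(1) config_ball_bounds[of n "ys @ R" a] unfolding increasing_block_iff by auto
  then have "ys \<noteq> []" using not by auto
  then have "?X ?l = last ys" by (auto simp: config_def nth_append last_conv_nth Suc_le_eq nat_diff_distrib)
  moreover have "?X (?l + 1) = hd R" using assms(3) by (simp add: config_def nth_append hd_conv_nth Suc_le_eq)
  ultimately show False using l(1,2) assms(2) \<open>ys \<noteq> []\<close> by (auto simp: separated_def)
qed

lemma increasing_run_append:
  assumes "increasing_run n (config (Suc n) ys) \<rho>" "separated (Suc n) ys R" "R \<noteq> []"
  shows "increasing_run n (config (Suc n) (ys @ R)) \<rho>"
proof -
  let ?e = "Suc n"
  obtain a b where run: "run_interval n (config ?e ys) a b" and \<rho>: "\<rho> = map (config ?e ys) [a..b]"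
    using assms(1) by (auto simp: increasing_run_def)
  note ab = run_interval_bounds[OF run]
  have same: "increasing_block n (config ?e (ys @ R)) a' b' = increasing_block n (config ?e ys) a' b'"
    if "b' \<le> int (length ys)" for a' b'
    using that by (auto simp: increasing_block_iff config_append_left)
  have "a' = a \<and> b' = b"
    if "increasing_block n (config ?e (ys @ R)) a' b'" "{a..b} \<subseteq> {a'..b'}" for a' b'
  proof -
    have "a' \<le> a" using that(2) ab by auto
    then have "b' \<le> int (length ys)" using block_separated[OF that(1) assms(2,3)] ab by linarith
    then show ?thesis using that same run unfolding run_interval_def by blast
  qed
  then have "run_interval n (config ?e (ys @ R)) a b"
    using run same ab unfolding run_interval_def by blast
  moreover have "\<rho> = map (config ?e (ys @ R)) [a..b]"
    using ab by (auto simp: \<rho> config_append_left)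
  ultimately show ?thesis by (auto simp: increasing_run_def)
qed

lemma last_run:
  assumes "separated (Suc n) ys R" "R \<noteq> []" "sorted_wrt (<) R" "set R \<subseteq> {1..n}"
  defines "a \<equiv> int (length ys) + 1" and "b \<equiv> int (length ys + length R)"
  shows "run_interval n (config (Suc n) (ys @ R)) a b" "map (config (Suc n) (ys @ R)) [a..b] = R"
proof -
  let ?X = "config (Suc n) (ys @ R)"
  have X: "?X p = R ! nat (p - a)" if "a \<le> p" "p \<le> b" for p
  proof -
    have "nat (p - 1) - length ys = nat (p - a)" "\<not> nat (p - 1) < length ys"
      using that by (auto simp: a_def b_def)
    then show ?thesis using that by (auto simp: config_def nth_append a_def b_def)
  qed
  have "1 \<le> length R" using assms(2) by (simp add: Suc_le_eq)
  then have "a \<le> b" by (simp add: a_def b_def)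
  have ball: "?X p \<in> {1..n}" if "a \<le> p" "p \<le> b" for p
  proof -
    have "nat (p - a) < length R" using that by (auto simp: a_def b_def)
    then show ?thesis using X[OF that] assms(4) nth_mem by fastforce
  qed
  have "?X i < ?X (i + 1)" if "a \<le> i" "i < b" for i
  proof -
    have "nat (i + 1 - a) = Suc (nat (i - a))" using that by simp
    moreover have "Suc (nat (i - a)) < length R" using that by (auto simp: a_def b_def)
    ultimately show ?thesis using that X[of i] X[of "i + 1"] assms(3)
      by (simp add: sorted_wrt_iff_nth_less)
  qed
  then have block: "increasing_block n ?X a b" using \<open>a \<le> b\<close> ball by (auto simp: increasing_block_iff)
  have "a' = a \<and> b' = b" if "increasing_block n ?X a' b'" "{a..b} \<subseteq> {a'..b'}" for a' b'
  proof -
    have "a' \<le> a" "b \<le> b'" "a' \<le> b'" using that(2) \<open>a \<le> b\<close> by auto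
    moreover have "?X b' \<in> {1..n}" using that(1) \<open>a' \<le> b'\<close> by (auto simp: increasing_block_iff)
    then have "b' \<le> b" using config_ball_bounds[of n "ys @ R" b'] by (simp add: b_def)
    moreover have "a \<le> a'" using block_separated[OF that(1) assms(1,2)] \<open>b \<le> b'\<close> \<open>a \<le> b\<close>
      by (auto simp: a_def)
    ultimately show ?thesis by simp
  qed
  then show "run_interval n ?X a b" using block by (auto simp: run_interval_def)
  show "map ?X [a..b] = R"
  proof (rule nth_equalityI)
    show len: "length (map ?X [a..b]) = length R" by (simp add: a_def b_def)
    fix i assume "i < length (map ?X [a..b])"
    then have "i < length R" using len by simp
    then show "map ?X [a..b] ! i = R ! i"
      using X[of "a + int i"] len by (simp add: nth_upto a_def b_def)
  qed
qed

lemma last_run_increasing: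
  assumes "separated (Suc n) ys R" "R \<noteq> []" "sorted_wrt (<) R" "set R \<subseteq> {1..n}"
  shows "increasing_run n (config (Suc n) (ys @ R)) R"
  using last_run[OF assms] unfolding increasing_run_def by metis

lemma run_ending_last_is_rightmost:
  assumes "run_interval n (config (Suc n) xs) a b" "b = int (length xs)"
    "run_interval n (config (Suc n) xs) a' b'"
  shows "a' \<le> a"
proof (rule ccontr)
  assume "\<not> ?thesis"
  then have "a < a'" by simp
  then have "a = a'" using run_interval_overlap[OF assms(1,3)] run_interval_bounds[OF assms(3)] assms(2) by linarith
  then show False using \<open>a < a'\<close> by simp
qed

section \<open>Separation of the rightmost soliton\<close>

lemma carrier_prefix:
  "\<forall>p\<in>set P. \<forall>q\<in>set Q. p \<le> q \<Longrightarrow> e \<notin> set Q \<Longrightarrow> carrier e (P @ D) Q = P @ carrier e D Q"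
proof (induction Q arbitrary: D)
  case (Cons q Q)
  have "load e q (P @ D) = P @ load e q D"
    using Cons.prems row_insert_append_max[of P q D] by (auto simp: load_def)
  then show ?case using Cons by simp
qed simp

text \<open>
  Let \<open>P\<close> be the letters of the list already read, and \<open>D\<close> what is left of the old carrier. If every
  letter of \<open>D\<close> has to disappear, the next letter \<open>q\<close> must bump the head of \<open>D\<close>: otherwise that head
  is smaller than \<open>q\<close> and all later letters, and stays in the carrier for good. Thus \<open>D\<close> is left
  behind in its own order, followed by empty boxes.
\<close>

lemma trail_absorbed_below:
  assumes "carrier e (P @ D) Q = P @ Q" "sorted (P @ Q)" "sorted (P @ D)" "e \<notin> set Q"
    "set D \<inter> set Q = {}"
  shows "(\<exists>j. trail e (P @ D) Q = D @ replicate j e) \<and> (D \<noteq> [] \<longrightarrow> Q \<noteq> [] \<and> hd Q < hd D)"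
  using assms
proof (induction Q arbitrary: P D)
  case Nil
  then show ?case by (auto intro: exI[of _ 0])
next
  case (Cons q Q)
  have Pq: "\<forall>p\<in>set P. p \<le> q" and q: "q \<noteq> e" using Cons.prems by (auto simp: sorted_append)
  show ?case
  proof (cases D)
    case Nil
    have ins: "row_insert q P = (P @ [q], None)" using row_insert_append_max[OF Pq, of "[]"] by simp
    have "\<exists>j. trail e ((P @ [q]) @ []) Q = [] @ replicate j e"
      using Cons.IH[of "P @ [q]" "[]"] Cons.prems ins q Nil by (simp add: load_def sorted_append)
    then obtain j where "trail e (P @ [q]) Q = replicate j e" by auto
    then have "trail e (P @ D) (q # Q) = D @ replicate (Suc j) e"
      using ins Nil q by (simp add: load_def unload_def)
    then show ?thesis using Nil by blast
  next
    case D: (Cons d D')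
    have "q < d"
    proof (rule ccontr)
      assume "\<not> q < d"
      then have "d < q" using Cons.prems(5) D by auto
      then have "\<forall>p\<in>set (P @ [d]). \<forall>r\<in>set (q # Q). p \<le> r"
        using Cons.prems(2,3) D Pq by (fastforce simp: sorted_append)
      from carrier_prefix[OF this Cons.prems(4), of D']
      have "P @ q # Q = (P @ [d]) @ carrier e D' (q # Q)"
        using Cons.prems(1) D by simp
      then show False using \<open>d < q\<close> by simp
    qed
    have ins: "row_insert q (P @ d # D') = (P @ q # D', Some d)"
      using row_insert_append_max[OF Pq, of "d # D'"] \<open>q < d\<close> by simp
    have "sorted (P @ q # D')" using Cons.prems(3) D Pq \<open>q < d\<close> by (fastforce simp: sorted_append)
    then have "\<exists>j. trail e ((P @ [q]) @ D') Q = D' @ replicate j e"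
      using Cons.IH[of "P @ [q]" D'] Cons.prems ins q D by (simp add: load_def)
    then show ?thesis using ins q D \<open>q < d\<close> by (auto simp: load_def unload_def)
  qed
qed

lemma trail_absorbed:
  assumes "carrier e C R = R" "sorted C" "sorted R" "e \<notin> set R" "set C \<inter> set R = {}"
  shows "\<exists>j. trail e C R = C @ replicate j e" "C \<noteq> [] \<Longrightarrow> R \<noteq> [] \<and> hd R < hd C"
  using trail_absorbed_below[of e "[]" C R] assms by auto

lemma in_load: "x \<noteq> e \<Longrightarrow> x \<in> set (load e x C)"
  by (cases rule: row_insert_cases[of C x]) (auto simp: load_def)

lemma last_in_carrier: "xs \<noteq> [] \<Longrightarrow> last xs \<noteq> e \<Longrightarrow> last xs \<in> set (carrier e C xs)"
  by (cases xs rule: rev_cases) (auto simp: in_load)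

lemma absorbed_disjoint:
  assumes "distinct (balls e (ys @ R))" "e \<notin> set R"
  shows "set (carrier e [] ys) \<inter> set R = {}"
  using assms set_carrier[of e "[]" ys] by (auto simp: balls_id)

text \<open>
  If the last box of \<open>ys\<close> holds a ball, this ball is in the carrier when \<open>R\<close> is reached, and
  \<open>hd R\<close> must bump the head of the carrier, which is at most that ball.
\<close>

lemma separated_absorbed:
  assumes "carrier e [] (ys @ R) = R" "distinct (balls e (ys @ R))" "sorted R" "e \<notin> set R"
  shows "separated e ys R"
proof (cases "ys = [] \<or> last ys = e")
  case False
  let ?C = "carrier e [] ys"
  have "last ys \<in> set ?C" using False by (intro last_in_carrier) auto
  moreover have "sorted ?C" by (simp add: sorted_carrier)
  ultimately have "hd ?C \<le> last ys" "?C \<noteq> []" by (cases ?C; auto)+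
  then show ?thesis
    using trail_absorbed(2)[of e ?C R] assms absorbed_disjoint[OF assms(2,4)] \<open>sorted ?C\<close>
    by (auto simp: separated_def)
qed (auto simp: separated_def)

lemma move_snoc_empty: "move e (xs @ [e]) = move e xs \<or> move e (xs @ [e]) = move e xs @ [e]"
  by (cases "carrier e [] xs") (auto simp: move_def load_def unload_def)

text \<open>
  Trailing empty boxes do not affect a configuration, but they do affect the list that represents
  it; the padding lemmas say that moves respect this ambiguity.
\<close>

lemma move_pad: "\<exists>j'. move e (xs @ replicate j e) = move e xs @ replicate j' e"
proof (induction j)
  case 0
  show ?case by (auto intro: exI[of _ 0])
next
  case (Suc j)
  let ?ys = "xs @ replicate j e"
  have "move e (?ys @ [e]) = move e ?ys \<or> move e (?ys @ [e]) = move e ?ys @ [e]"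
    by (rule move_snoc_empty)
  moreover have "xs @ replicate (Suc j) e = ?ys @ [e]" by (simp add: replicate_append_same)
  ultimately show ?case using Suc
    by (metis append.assoc replicate_Suc replicate_append_same)
qed

text \<open>
  The old carrier comes out in increasing order over the boxes of \<open>R\<close>, as it would over empty
  boxes. So \<open>ys\<close> moves as if \<open>R\<close> were absent, and \<open>R\<close> follows behind; the padding is the surplus
  of the length of \<open>R\<close> over that of the carrier of \<open>ys\<close>.
\<close>

lemma move_absorbed:
  assumes "carrier e [] (ys @ R) = R" "distinct (balls e (ys @ R))" "sorted R" "e \<notin> set R"
  shows "\<exists>j. move e (ys @ R) = (move e ys @ replicate j e) @ R"
  using trail_absorbed(1)[of e "carrier e [] ys" R] assms absorbed_disjoint[OF assms(2,4)]
  by (auto simp: move_def sorted_carrier)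

lemma mset_balls_move_funpow: "mset (balls e ((move e ^^ t) xs)) = mset (balls e xs)"
  by (induction t) (auto simp: mset_balls_move)

lemma balls_move_funpow:
  "set (balls e ((move e ^^ t) xs)) = set (balls e xs)"
  "distinct (balls e ((move e ^^ t) xs)) = distinct (balls e xs)"
  using mset_eq_setD[OF mset_balls_move_funpow] mset_eq_imp_distinct_iff[OF mset_balls_move_funpow]
  by auto

lemma move_funpow_pad: "\<exists>j'. (move e ^^ t) (xs @ replicate j e) = (move e ^^ t) xs @ replicate j' e"
proof (induction t)
  case (Suc t)
  then obtain i where "(move e ^^ t) (xs @ replicate j e) = (move e ^^ t) xs @ replicate i e" by blast
  then show ?case using move_pad[of e "(move e ^^ t) xs" i] by simp
qed auto

lemma move_funpow_absorbed:
  assumes "\<And>t. carrier e [] ((move e ^^ t) (ys @ R)) = R"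
    "distinct (balls e (ys @ R))" "sorted R" "e \<notin> set R"
  shows "\<exists>j. (move e ^^ t) (ys @ R) = ((move e ^^ t) ys @ replicate j e) @ R"
proof (induction t)
  case 0
  show ?case by (auto intro: exI[of _ 0])
next
  case (Suc t)
  let ?ys = "(move e ^^ t) ys"
  from Suc obtain i where i: "(move e ^^ t) (ys @ R) = (?ys @ replicate i e) @ R" by blast
  obtain j where "move e ((?ys @ replicate i e) @ R) = (move e (?ys @ replicate i e) @ replicate j e) @ R"
    using move_absorbed[of e "?ys @ replicate i e" R] assms(1)[of t] i assms(2-4)
      balls_move_funpow(2)[of e t "ys @ R"] by auto
  moreover obtain k where "move e (?ys @ replicate i e) = move e ?ys @ replicate k e"
    using move_pad by blast
  ultimately have "(move e ^^ Suc t) (ys @ R) = ((move e ^^ Suc t) ys @ replicate (k + j) e) @ R"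
    using i by (simp add: replicate_add)
  then show ?case by blast
qed

section \<open>Existence of a steady state\<close>

lemma count_le_carrier_move:
  "count_le (carrier e [] xs) \<le> count_le (carrier e [] (move e xs))"
  using count_le_carrier_ge[of "carrier e [] (trail e [] xs)" "carrier e [] xs" e]
    empty_notin_carrier[of e "[]" xs]
  by (simp add: move_def sorted_carrier)

text \<open>
  By \<open>count_le_carrier_move\<close> the profiles of the final carriers increase with time, and they are bounded
  by the number of balls.
\<close>

lemma carrier_stabilises:
  assumes "set (balls e xs) \<subseteq> {..m}"
  shows "\<exists>T. \<forall>t\<ge>T. carrier e [] ((move e ^^ t) xs) = carrier e [] ((move e ^^ T) xs)"
proof -
  define C where "C t = carrier e [] ((move e ^^ t) xs)" for t
  \<comment> \<open>a numerical potential that detects any change of the profile\<close>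
  define h where "h t = (\<Sum>v\<le>m. count_le (C t) v)" for t
  have mono: "count_le (C s) v \<le> count_le (C t) v" if "s \<le> t" for s t v
    using that
  proof (induction rule: dec_induct)
    case (step t)
    then show ?case using count_le_carrier_move[of e "(move e ^^ t) xs"]
      by (auto simp: C_def le_fun_def intro: order_trans)
  qed simp
  have C_le: "set (C t) \<subseteq> {..m}" for t
    using set_carrier[of e "[]" "(move e ^^ t) xs"] assms balls_move_funpow(1)[of e t xs] by (auto simp: C_def)
  have len: "count_le (C t) v \<le> length (balls e xs)" for t v
  proof -
    have "count_le (C t) v \<le> length (C t)" by (simp add: count_le_def)
    also have "size (mset (C t)) \<le> size (mset (balls e ((move e ^^ t) xs)))"
      using arg_cong[OF mset_trail_carrier[of e "[]" "(move e ^^ t) xs"], of size] by (simp add: C_def)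
    then have "length (C t) \<le> length (balls e xs)"
      using mset_balls_move_funpow[of e t xs] by (metis size_mset)
    finally show ?thesis .
  qed
  have "h t \<le> (\<Sum>v\<le>m. length (balls e xs))" for t unfolding h_def by (intro sum_mono len)
  then obtain T where T: "\<And>t. h t \<le> h T"
    using ex_has_greatest_nat[of "\<lambda>_. True" 0 h] by (metis less_Suc_eq_le)
  have "C t = C T" if "T \<le> t" for t
  proof (rule count_le_inject)
    show "sorted (C t)" "sorted (C T)" by (auto simp: C_def sorted_carrier)
    have low: "count_le (C T) v = count_le (C t) v" if "v \<le> m" for v
    proof -
      have "h T = h t" using T[of t] mono[OF \<open>T \<le> t\<close>]
        by (simp add: h_def sum_mono order_antisym)
      then show ?thesis using sum_mono_inv[of "count_le (C T)" "{..m}" "count_le (C t)" v] mono[OF \<open>T \<le> t\<close>] that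
        by (simp add: h_def)
    qed
    \<comment> \<open>beyond the largest possible ball all profiles are constant\<close>
    have high: "count_le (C s) v = count_le (C s) m" if "m \<le> v" for s v
      unfolding count_le_def using C_le[of s] that by (intro arg_cong[of _ _ length] filter_cong) auto
    show "count_le (C t) = count_le (C T)"
      by (rule ext) (metis low high le_cases)
  qed
  then show ?thesis unfolding C_def by blast
qed

text \<open>
  The steady-state condition in terms of \<open>move\<close>, which makes sense for any set of balls; \<open>bb\<close> needs all
  of \<open>1, \<dots>, n\<close> to be present and could not serve in an induction that removes balls.
\<close>

definition settled :: "nat \<Rightarrow> nat list \<Rightarrow> bool" where
  "settled n xs \<longleftrightarrow>
     (\<forall>k\<in>set (balls (Suc n) xs). \<exists>\<rho>. k \<in> set \<rho> \<and>
        (\<forall>s. increasing_run n (config (Suc n) ((move (Suc n) ^^ s) xs)) \<rho>))"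

lemma settled_pad:
  assumes "settled n xs" shows "settled n (xs @ replicate j (Suc n))"
proof -
  have "config (Suc n) ((move (Suc n) ^^ s) (xs @ replicate j (Suc n))) = config (Suc n) ((move (Suc n) ^^ s) xs)" for s
    using move_funpow_pad[where e = "Suc n" and t = s and xs = xs and j = j] config_append_empty by metis
  then show ?thesis using assms by (simp add: settled_def)
qed

lemma strip_empty: obtains ys j where "xs = ys @ replicate j e" "ys = [] \<or> last ys \<noteq> e"
proof (induction xs arbitrary: thesis rule: rev_induct)
  case Nil
  then show ?case by (metis append.right_neutral replicate_0)
next
  case (snoc x xs)
  show ?case
  proof (cases "x = e")
    case True
    obtain ys j where "xs = ys @ replicate j e" "ys = [] \<or> last ys \<noteq> e" using snoc.IH by blast
    then show ?thesis using snoc.prems[of ys "Suc j"] True by (simp add: replicate_append_same)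
  next
    case False
    then show ?thesis using snoc.prems[of "xs @ [x]" 0] by simp
  qed
qed

lemma carrier_sorted_strict:
  assumes "distinct (balls e xs)"
  shows "sorted_wrt (<) (carrier e [] xs)"
proof -
  have "mset (balls e (trail e [] xs) @ carrier e [] xs) = mset (balls e xs)"
    using mset_trail_carrier[of e "[]" xs] by simp
  then have "distinct (carrier e [] xs)"
    using assms mset_eq_imp_distinct_iff distinct_append by blast
  then show ?thesis by (simp add: strict_sorted_iff sorted_carrier)
qed

lemma carrier_nonempty: "xs \<noteq> [] \<and> last xs \<noteq> e \<Longrightarrow> carrier e C xs \<noteq> []"
  using last_in_carrier[of xs e C] by auto

text \<open>
  A list that ends in a ball keeps a nonempty final carrier at all times, because its last ball is
  the last to enter the carrier.
\<close>

lemma ends_in_ball_funpow: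
  "xs \<noteq> [] \<and> last xs \<noteq> e \<Longrightarrow> (move e ^^ t) xs \<noteq> [] \<and> last ((move e ^^ t) xs) \<noteq> e"
proof (induction t)
  case (Suc t)
  let ?C = "carrier e [] ((move e ^^ t) xs)"
  have "?C \<noteq> []" using Suc carrier_nonempty by blast
  moreover have "e \<notin> set ?C" by (simp add: empty_notin_carrier)
  ultimately have "last ?C \<noteq> e" by (metis last_in_set)
  then show ?case using \<open>?C \<noteq> []\<close> by (simp add: move_def[of e "(move e ^^ t) xs"])
qed simp

text \<open>
  Once the final carrier is constant, equal to \<open>R\<close>, its balls form a soliton that leaves the others
  undisturbed, so the induction hypothesis applies to the others on their own. The removal of \<open>R\<close>
  creates trailing empty boxes, which are stripped first in order that \<open>R\<close> is nonempty.
\<close>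

lemma eventually_settled:
  assumes "set (balls (Suc n) xs) \<subseteq> {1..n}" "distinct (balls (Suc n) xs)"
  shows "\<exists>t. settled n ((move (Suc n) ^^ t) xs)"
  using assms
proof (induction "length (balls (Suc n) xs)" arbitrary: xs rule: less_induct)
  case less
  let ?e = "Suc n"
  let ?M = "move ?e"
  obtain zs j where zs: "xs = zs @ replicate j ?e" "zs = [] \<or> last zs \<noteq> ?e" by (rule strip_empty)
  have bz: "balls ?e zs = balls ?e xs" using zs by simp
  have "\<exists>t. settled n ((?M ^^ t) zs)"
  proof (cases "zs = []")
    case True
    then show ?thesis by (auto intro!: exI[of _ 0] simp: settled_def)
  next
    case False
    obtain T where T: "\<And>t. t \<ge> T \<Longrightarrow> carrier ?e [] ((?M ^^ t) zs) = carrier ?e [] ((?M ^^ T) zs)"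
      using carrier_stabilises[of ?e zs n] less.prems bz by fastforce
    define R where "R = carrier ?e [] ((?M ^^ T) zs)"
    define us where "us = trail ?e [] ((?M ^^ T) zs)"
    have usR: "(?M ^^ Suc T) zs = us @ R" by (simp add: us_def R_def move_def)
    have absorbed: "carrier ?e [] ((?M ^^ s) (us @ R)) = R" for s
    proof -
      have "(?M ^^ s) (us @ R) = (?M ^^ (s + Suc T)) zs" by (simp only: funpow_add o_apply usR)
      then show ?thesis using T[of "s + Suc T"] by (simp add: R_def)
    qed
    have R: "sorted_wrt (<) R" "sorted R" "?e \<notin> set R" "set R \<subseteq> {1..n}"
      using carrier_sorted_strict balls_move_funpow less.prems set_carrier[of ?e "[]" "(?M ^^ T) zs"]
        bz empty_notin_carrier[of ?e "[]"] by (auto simp: R_def sorted_carrier)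
    have ms: "mset (balls ?e (us @ R)) = mset (balls ?e xs)"
      using mset_balls_move_funpow[of ?e "Suc T" zs] usR bz by simp
    have dist: "distinct (balls ?e (us @ R))"
      using less.prems(2) mset_eq_imp_distinct_iff[OF ms] by simp
    have "R \<noteq> []"
      using carrier_nonempty ends_in_ball_funpow[of zs ?e T] zs(2) False by (simp add: R_def)
    have "length (balls ?e us) < length (balls ?e xs)"
      using arg_cong[OF ms, of size] \<open>R \<noteq> []\<close> balls_id[OF R(3)] by (cases R) auto
    moreover have "set (balls ?e us) \<subseteq> {1..n}" "distinct (balls ?e us)"
      using mset_eq_setD[OF ms] less.prems(1) dist by auto
    ultimately obtain t where t: "settled n ((?M ^^ t) us)" using less.hyps by blast
    have run: "\<exists>j. (?M ^^ s) (us @ R) = ((?M ^^ s) us @ replicate j ?e) @ R \<and>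
        separated ?e ((?M ^^ s) us @ replicate j ?e) R" for s
    proof -
      obtain j where j: "(?M ^^ s) (us @ R) = ((?M ^^ s) us @ replicate j ?e) @ R"
        using move_funpow_absorbed[of ?e us R s] absorbed dist R(2,3) by blast
      then show ?thesis
        using separated_absorbed[of ?e "(?M ^^ s) us @ replicate j ?e" R] absorbed[of s] R(2,3)
          dist balls_move_funpow(2)[of ?e s "us @ R"] by auto
    qed
    have "settled n ((?M ^^ t) (us @ R))"
      unfolding settled_def
    proof
      fix k assume k: "k \<in> set (balls ?e ((?M ^^ t) (us @ R)))"
      have later: "(?M ^^ s) ((?M ^^ t) zs) = (?M ^^ (s + t)) zs" for s zs by (simp add: funpow_add)
      show "\<exists>\<rho>. k \<in> set \<rho> \<and> (\<forall>s. increasing_run n (config ?e ((?M ^^ s) ((?M ^^ t) (us @ R)))) \<rho>)"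
      proof (cases "k \<in> set R")
        case True
        have "increasing_run n (config ?e ((?M ^^ s) ((?M ^^ t) (us @ R)))) R" for s
          using run[of "s + t"] last_run_increasing[OF _ \<open>R \<noteq> []\<close> R(1) R(4)] by (metis later)
        then show ?thesis using True by blast
      next
        case False
        then have "k \<in> set (balls ?e ((?M ^^ t) us))"
          using k balls_move_funpow(1)[of ?e t] balls_id[OF R(3)] by auto
        then obtain \<rho> where "k \<in> set \<rho>"
          and \<rho>: "\<And>s. increasing_run n (config ?e ((?M ^^ s) ((?M ^^ t) us))) \<rho>"
          using t unfolding settled_def by blast
        moreover have "increasing_run n (config ?e ((?M ^^ s) ((?M ^^ t) (us @ R)))) \<rho>" for s
        proof -
          obtain j where "(?M ^^ (s + t)) (us @ R) = ((?M ^^ (s + t)) us @ replicate j ?e) @ R"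
            "separated ?e ((?M ^^ (s + t)) us @ replicate j ?e) R" using run by blast
          then show ?thesis using \<rho>[of s] \<open>R \<noteq> []\<close>
            by (simp only: later) (metis config_append_empty increasing_run_append)
        qed
        ultimately show ?thesis by blast
      qed
    qed
    then have "settled n ((?M ^^ (t + Suc T)) zs)" by (simp only: funpow_add o_apply usR)
    then show ?thesis by blast
  qed
  then obtain t where "settled n ((?M ^^ t) zs)" ..
  then show ?case using move_funpow_pad[where e = ?e and t = t and xs = zs and j = j] settled_pad zs(1) by metis
qed

section \<open>The first soliton of a permutation\<close>

lemma perm_config_eq: "perm_config n w = config (Suc n) (map w [1..<Suc n])"
  by (auto simp: perm_config_def config_def fun_eq_iff nat_diff_distrib simp del: upt_Suc)

lemma row1_fold_rs_insert:
  "ws \<noteq> [] \<or> T \<noteq> [] \<Longrightarrow>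
   row1 (fold rs_insert ws T) = fold (\<lambda>x C. fst (row_insert x C)) ws (if T = [] then [] else row1 T)"
proof (induction ws arbitrary: T)
  case (Cons x ws)
  have "rs_insert x T \<noteq> []" "row1 (rs_insert x T) = fst (row_insert x (if T = [] then [] else row1 T))"
    by (cases T; auto simp: row1_def split: prod.splits option.splits)+
  then show ?case using Cons.IH[of "rs_insert x T"] by simp
qed simp

lemma carrier_eq_row1:
  assumes "ws \<noteq> []" "e \<notin> set ws"
  shows "carrier e [] ws = row1 (fold rs_insert ws [])"
proof -
  have "carrier e C ws = fold (\<lambda>x C. fst (row_insert x C)) ws C" for C
    using assms(2) by (induction ws arbitrary: C) (auto simp: load_def)
  then show ?thesis using row1_fold_rs_insert[of ws "[]"] assms(1) by simp
qed

lemma count_le_carrier_word: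
  "e \<notin> set ws \<Longrightarrow> count_le (carrier e [] ws) = fold lis_step ws (\<lambda>_. 0)"
  using count_le_carrier[of "[]" e ws] by (simp add: count_le_Nil fold_carrier_step_eq_lis_step)

text \<open>
  The lower bound is the growth of carrier profiles with time; the upper bound combines the
  invariance of the word profile under moves with the loss at gaps. The initial word has no gaps,
  so that at the start both bounds coincide.
\<close>

lemma carrier_move_funpow:
  assumes "e \<notin> set ws"
  shows "carrier e [] ((move e ^^ t) ws) = carrier e [] ws"
proof (rule count_le_inject)
  let ?F = "fold lis_step ws (\<lambda>_. 0)"
  have F: "count_le (carrier e [] ws) = ?F"
    using assms by (rule count_le_carrier_word)
  have inv: "fold lis_step (balls e ((move e ^^ t) ws)) (\<lambda>_. 0) = ?F"
    by (induction t) (use assms in \<open>simp_all add: fold_lis_step_move monoI balls_id\<close>)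
  have ge: "count_le (carrier e [] ws) \<le> count_le (carrier e [] ((move e ^^ t) ws))"
    by (induction t) (auto intro: order_trans count_le_carrier_move)
  have "count_le (carrier e [] ((move e ^^ t) ws)) \<le> ?F"
    using fold_carrier_step_le_lis_step[of e "(move e ^^ t) ws" "\<lambda>_. 0"] inv
    by (simp add: count_le_carrier count_le_Nil)
  then show "count_le (carrier e [] ((move e ^^ t) ws)) = count_le (carrier e [] ws)"
    using ge F by simp
qed (auto simp: sorted_carrier)

text \<open>
  For \<open>x = 1\<close> this puts the ball \<open>1\<close> into the first soliton. The one-letter subsequence \<open>x\<close> makes
  the profile positive at \<open>x\<close>.
\<close>

lemma mem_carrier_least:
  assumes "e \<notin> set ws" "x \<in> set ws"
  shows "\<exists>c\<in>set (carrier e [] ws). c \<le> x"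
proof (rule ccontr)
  assume "\<not> ?thesis"
  then have 0: "count_le (carrier e [] ws) x = 0" by (intro count_le_eq_0) auto
  obtain us vs where ws: "ws = us @ x # vs" using assms(2) by (meson split_list)
  let ?f = "lis_step x (fold lis_step us (\<lambda>_. 0))"
  have "Suc 0 \<le> ?f x" by (simp add: lis_step_def)
  also have "?f x \<le> fold lis_step vs ?f x" using fold_lis_step_increasing[of ?f vs] by (simp add: le_fun_def)
  also have "\<dots> = count_le (carrier e [] ws) x"
    using count_le_carrier_word[OF assms(1)] ws by simp
  finally show False using 0 by simp
qed

lemma config_inject_ball:
  assumes "distinct (balls e xs)" "config e xs p = config e xs q" "config e xs p \<noteq> e"
  shows "p = q"
proof -
  have no_repeat: "xs ! i \<noteq> xs ! j" if "i < j" "j < length xs" "xs ! i \<noteq> e" for i j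
  proof
    assume eq: "xs ! i = xs ! j"
    have "drop (Suc i) xs ! (j - Suc i) = xs ! j" "j - Suc i < length (drop (Suc i) xs)"
      using that by simp_all
    then have "xs ! j \<in> set (drop (Suc i) xs)" by (metis nth_mem)
    moreover have "xs = take i xs @ xs ! i # drop (Suc i) xs" using that by (simp add: id_take_nth_drop)
    then have "balls e xs = balls e (take i xs) @ xs ! i # balls e (drop (Suc i) xs)"
      using that(3) by (metis balls_simps(2,3))
    then have "xs ! i \<notin> set (balls e (drop (Suc i) xs))" using assms(1) by simp
    ultimately show False using eq that(3) by (simp add: set_balls)
  qed
  obtain i where i: "i < length xs" "p = int i + 1" "xs ! i = config e xs p"
    using assms(3) by (rule config_eqD[OF refl])
  obtain j where j: "j < length xs" "q = int j + 1" "xs ! j = config e xs q"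
    using assms(2,3) by (metis config_eqD)
  then have "i = j" using i no_repeat[of i j] no_repeat[of j i] assms(2,3) by (metis nat_neq_iff)
  then show ?thesis using i j by simp
qed

theorem theorem5p5:
  fixes n :: nat and w :: "nat \<Rightarrow> nat"
  assumes "n \<ge> 1" and "w permutes {1..n}"
  shows "1 \<in> set (row1 (SD n w)) \<and>
         (\<forall>t\<ge>1. rightmost_run n ((bb n ^^ t) (perm_config n w)) (row1 (SD n w))) \<and>
         row1 (SD n w) = row1 (P_tableau n w)"
proof -
  define e where "e = Suc n"
  define ws where "ws = map w [1..<Suc n]"
  define R where "R = carrier e [] ws"
  define xs where "xs t = (move e ^^ t) ws" for t
  define X where "X t = (bb n ^^ t) (perm_config n w)" for t
  have set_ws: "set ws = {1..n}"
    using permutes_image[OF assms(2)] by (auto simp: ws_def atLeastLessThanSuc_atLeastAtMost simp del: upt_Suc)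
  have "distinct ws"
    using permutes_inj_on[OF assms(2)] by (simp add: ws_def distinct_map del: upt_Suc)
  have "ws \<noteq> []" "e \<notin> set ws" using set_ws assms(1) by (auto simp: e_def)
  note ws = set_ws \<open>distinct ws\<close> this
  have balls: "set (balls e (xs t)) = {1..n}" "distinct (balls e (xs t))" for t
    using balls_move_funpow[of e t ws] ws by (simp_all add: xs_def balls_id)
  have X: "X t = config e (xs t)" for t
  proof (induction t)
    case 0
    then show ?case by (simp add: X_def xs_def perm_config_eq ws_def e_def)
  next
    case (Suc t)
    then show ?case using bb_config[of n "xs t"] balls[of t] by (simp add: X_def xs_def e_def)
  qed
  have carrier: "carrier e [] (xs t) = R" for t
    using carrier_move_funpow[OF ws(4)] by (simp add: xs_def R_def)
  have R: "sorted R" "sorted_wrt (<) R" "e \<notin> set R" "set R \<subseteq> {1..n}"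
    using carrier_sorted_strict[of e ws] set_carrier[of e "[]" ws] empty_notin_carrier[of e "[]" ws] ws
    by (auto simp: R_def sorted_carrier balls_id)
  have "last ws \<noteq> e" using ws by (metis last_in_set)
  then have "R \<noteq> []" using carrier_nonempty ws(3) by (simp add: R_def)
  define us where "us t = trail e [] (xs t)" for t
  have us: "xs (Suc t) = us t @ R" for t
    using carrier[of t] by (simp add: us_def xs_def move_def[of e "(move e ^^ t) ws"])
  have sep: "separated e (us t) R" for t
    using separated_absorbed[of e "us t" R] carrier[of "Suc t"] balls(2)[of "Suc t"] R us[of t] by simp
  \<comment> \<open>so box \<open>length (xs t)\<close> is the last occupied one at time \<open>t\<close>\<close>
  have last_xs: "xs t \<noteq> [] \<and> last (xs t) \<noteq> e" for t
    using ends_in_ball_funpow[of ws e t] ws(3) \<open>last ws \<noteq> e\<close> by (simp add: xs_def)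
  have R_run: "run_interval n (X (Suc t)) (int (length (us t)) + 1) (int (length (xs (Suc t))))"
    "map (X (Suc t)) [int (length (us t)) + 1..int (length (xs (Suc t)))] = R" for t
    using last_run[of n "us t" R] sep \<open>R \<noteq> []\<close> R X[of "Suc t"] us[of t] by (simp_all add: e_def)

  have rightmost: "rightmost_run n (X t) R" if "1 \<le> t" for t
  proof -
    obtain s where t: "t = Suc s" using \<open>1 \<le> t\<close> by (cases t) auto
    have "\<forall>a' b'. run_interval n (X t) a' b' \<longrightarrow> a' \<le> int (length (us s)) + 1"
      using run_ending_last_is_rightmost[of n "xs t"] R_run(1)[of s] X[of t] t by (metis e_def)
    then show ?thesis unfolding rightmost_run_def using R_run[of s] t by metis
  qed

  have "row1 (SD n w) = R"
  proof -
    have "\<exists>t. steady n (X t)"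
    proof -
      obtain t where "settled n (xs t)"
        using eventually_settled[of n ws] ws by (auto simp: xs_def e_def balls_id)
      moreover have "(bb n ^^ s) (X t) = config e ((move e ^^ s) (xs t))" for s
        using X[of "s + t"] by (simp add: X_def xs_def funpow_add)
      ultimately have run: "\<exists>\<rho>. k \<in> set \<rho> \<and> (\<forall>s. increasing_run n ((bb n ^^ s) (X t)) \<rho>)"
        if "k \<in> {1..n}" for k
        using that balls(1)[of t] by (simp add: settled_def e_def)
      have "\<exists>a b. soliton_interval n (X t) a b \<and> k \<in> X t ` {a..b}" if k: "k \<in> {1..n}" for k
      proof -
        obtain \<rho> where \<rho>: "k \<in> set \<rho>" "\<And>s. increasing_run n ((bb n ^^ s) (X t)) \<rho>"
          using run[OF k] by blast
        obtain a b where "run_interval n (X t) a b" "\<rho> = map (X t) [a..b]"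
          using \<rho>(2)[of 0] by (auto simp: increasing_run_def)
        then show ?thesis using \<rho> unfolding soliton_interval_def by (metis list.set_map set_upto)
      qed
      then show ?thesis unfolding steady_def by blast
    qed
    then have "steady n (X (SOME t. steady n (X t)))" by (rule someI_ex)
    then obtain t where t: "t = (SOME t. steady n (X t))" "steady n (X t)" by blast
    let ?l = "int (length (xs t))"
    have "last (xs t) \<in> {1..n}"
      using last_xs[of t] balls(1)[of t] by (metis set_balls last_in_set Diff_iff singletonD)
    then obtain a b where sol: "soliton_interval n (X t) a b" and last: "last (xs t) \<in> X t ` {a..b}"
      using t(2) unfolding steady_def by blast
    have inj: "i = j" if "X t i = X t j" "X t i \<in> {1..n}" for t i j
      using that config_inject_ball[OF balls(2)[of t], of i j] by (simp add: X e_def)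
    have X_last: "X t ?l = last (xs t)"
      using last_xs[of t] by (simp add: X config_def last_conv_nth nat_diff_distrib Suc_le_eq)
    have run: "run_interval n (X t) a b" using sol by (simp add: soliton_interval_def)
    have "b = ?l"
    proof -
      have "?l \<in> {a..b}" using last inj[where t = t and i = ?l] X_last \<open>last (xs t) \<in> {1..n}\<close> by auto
      moreover have "b \<le> ?l" using run_interval_bounds[of n "xs t" a b] run X by (simp add: e_def)
      ultimately show ?thesis by simp
    qed
    let ?A = "{a. \<exists>b. soliton_interval n (X t) a b}"
    have "?A \<subseteq> {1..?l}"
      using run_interval_bounds[of n "xs t"] X[of t] by (force simp: soliton_interval_def e_def)
    then have fin: "finite ?A" by (rule finite_subset) simp
    let ?L = "sorted_list_of_set ?A"
    have L: "sorted ?L" "set ?L = ?A" "?L \<noteq> []" using fin sol by auto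
    have "last ?L = a"
    proof (rule antisym)
      have "last ?L \<in> ?A" using last_in_set[OF L(3)] L(2) by simp
      then show "last ?L \<le> a"
        using run_ending_last_is_rightmost[of n "xs t" a b] run \<open>b = ?l\<close> X[of t]
        by (auto simp: soliton_interval_def e_def)
      have "a \<in> set ?L" using sol L(2) by blast
      then show "a \<le> last ?L"
        using L(1,3) by (cases ?L rule: rev_cases) (auto simp: sorted_append)
    qed
    then have "hd (rev ?L) = a" using L(3) by (simp add: hd_rev)
    have b: "(THE b. soliton_interval n (X t) a b) = b"
      using sol run_interval_unique_end by (intro the_equality) (auto simp: soliton_interval_def)
    have "row1 (soliton_rows n (X t)) = map (X t) [a..b]"
      using b L(3) \<open>hd (rev ?L) = a\<close> by (simp add: row1_def soliton_rows_def hd_map)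
    \<comment> \<open>the soliton survives the next move, and its ball \<open>last (xs t)\<close> is then in the run \<open>R\<close>\<close>
    moreover have "map (X t) [a..b] = R"
    proof -
      let ?Y = "X (Suc t)" and ?\<rho> = "map (X t) [a..b]"
      let ?c = "int (length (us t)) + 1" and ?d = "int (length (xs (Suc t)))"
      have "increasing_run n ((bb n ^^ 1) (X t)) ?\<rho>" using sol unfolding soliton_interval_def by blast
      then obtain a' b' where a'b': "run_interval n ?Y a' b'" "?\<rho> = map ?Y [a'..b']"
        by (auto simp: increasing_run_def X_def)
      have "last (xs t) \<in> set R"
        using last_in_carrier[of "xs t" e "[]"] last_xs[of t] carrier[of t] by simp
      then have "last (xs t) \<in> set (map ?Y [?c..?d])" by (simp only: R_run(2))
      then obtain q where q: "?c \<le> q" "q \<le> ?d" "?Y q = last (xs t)" by auto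
      have "last (xs t) \<in> set ?\<rho>" using last by simp
      then obtain p where p: "a' \<le> p" "p \<le> b'" "?Y p = last (xs t)" unfolding a'b'(2) by auto
      have "p = q" using inj[where t = "Suc t" and i = p and j = q] p q \<open>last (xs t) \<in> {1..n}\<close> by simp
      then have "a' = ?c \<and> b' = ?d" using run_interval_overlap[OF a'b'(1) R_run(1)[of t]] p q by linarith
      then show ?thesis using a'b'(2) R_run(2)[of t] by simp
    qed
    ultimately show ?thesis using t(1) by (simp add: SD_def X_def Let_def)
  qed
  moreover have "R = row1 (P_tableau n w)"
    using carrier_eq_row1[OF ws(3,4)] by (simp add: R_def P_tableau_def ws_def)
  moreover have "1 \<in> set R"
    using mem_carrier_least[OF ws(4), of 1] ws(1) assms(1) R(4) by (fastforce simp: R_def)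
  ultimately show ?thesis using rightmost unfolding X_def by metis
qed

end
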